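(* Let $G$ be a finite bipartite graph with parts $L\sqcup R$, left-regular of degree $d$, and let $n=|L|$. For any integer $s$ with $2\le s\le n$ the following are equivalent: (1) $g(G)>2s$, where $g(G)$ is the girth of $G$. (2) $G$ is an $s$-optimal small-set expander, that is, $\alpha_G(t)\ge (d-1)+\frac1t$ for every integer $t$ with $1\le t\le s$.
   Context: Graphs are finite and simple. A bipartite graph $G$ with parts $L\sqcup R$ is left-regular of degree $d$ if every vertex of $L$ has exactly $d$ incident edges. For $X\subseteq L$, $N(X)\subseteq R$ is the set of vertices adjacent to at least one vertex of $X$. For an integer $1\le t\le |L|$, $$\alpha_G(t):=\min\left\{\frac{|N(X)|}{|X|}: X\subseteq L,\ 0<|X|\le t\right\}.$$ The girth $g(G)$ is the number of vertices of a shortest simple cycle contained in $G$ (and is $+\infty$ if $G$ has no cycles). *)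

theory Defs
  imports Complex_Main "HOL-Library.Extended_Nat" "Graph_Theory.Graph_Theory"
begin

text \<open>
  A finite simple graph is the locale \<open>graph\<close> of \<open>Graph_Theory\<close>: a finite, symmetric digraph
  without loops and parallel arcs. Each edge is thus a pair of opposite arcs, and the number of edges
  incident to \<open>v\<close> is \<open>out_degree G v\<close>.
\<close>

definition bipartite_graph :: "('a, 'b) pre_digraph \<Rightarrow> 'a set \<Rightarrow> 'a set \<Rightarrow> bool" where
  "bipartite_graph G L R \<longleftrightarrow> graph G \<and> verts G = L \<union> R \<and> L \<inter> R = {} \<and>
     (\<forall>e \<in> arcs G. (tail G e \<in> L \<and> head G e \<in> R) \<or> (tail G e \<in> R \<and> head G e \<in> L))"

definition left_regular :: "('a, 'b) pre_digraph \<Rightarrow> 'a set \<Rightarrow> nat \<Rightarrow> bool" where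
  "left_regular G L d \<longleftrightarrow> (\<forall>v \<in> L. out_degree G v = d)"

definition neighbourhood :: "('a, 'b) pre_digraph \<Rightarrow> 'a set \<Rightarrow> 'a set" where
  "neighbourhood G X = {v \<in> verts G. \<exists>u \<in> X. u \<rightarrow>\<^bsub>G\<^esub> v}"

text \<open>
  \<open>Min\<close> is meaningful here for finite \<open>L\<close> and \<open>1 \<le> t \<le> card L\<close>.
\<close>

definition expansion :: "('a, 'b) pre_digraph \<Rightarrow> 'a set \<Rightarrow> nat \<Rightarrow> real" where
  "expansion G L t =
     Min {real (card (neighbourhood G X)) / real (card X) | X. X \<subseteq> L \<and> 0 < card X \<and> card X \<le> t}"

text \<open>
  The library's \<open>cycle\<close> also holds of the closed walk that traverses an edge back and forth; in a
  graph without loops and parallel arcs, demanding length at least 3 excludes exactly these.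
\<close>

definition simple_cycle :: "('a, 'b) pre_digraph \<Rightarrow> 'b list \<Rightarrow> bool" where
  "simple_cycle G p \<longleftrightarrow> pre_digraph.cycle G p \<and> 3 \<le> length p"

text \<open>
  The vertices of a cycle are the tails of its arcs. The infimum of the empty set is \<open>\<infinity>\<close>.
\<close>

definition girth :: "('a, 'b) pre_digraph \<Rightarrow> enat" where
  "girth G = (INF p \<in> {p. simple_cycle G p}. enat (card (tail G ` set p)))"

definition optimal_small_set_expander :: "('a, 'b) pre_digraph \<Rightarrow> 'a set \<Rightarrow> nat \<Rightarrow> nat \<Rightarrow> bool" where
  "optimal_small_set_expander G L d s \<longleftrightarrow>
     (\<forall>t. 1 \<le> t \<and> t \<le> s \<longrightarrow> expansion G L t \<ge> (real d - 1) + 1 / real t)"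

end

theory Submission
  imports Defs
begin

text \<open>
  Optimality says that \<open>|N(X)| \<ge> (d - 1)|X| + 1\<close> for all nonempty \<open>X \<subseteq> L\<close> with at most \<open>s\<close>
  elements. A cycle through the set \<open>K \<subseteq> L\<close> violates this for \<open>X = K\<close>: of the \<open>d|K|\<close> edges
  leaving \<open>K\<close>, the \<open>|K|\<close> forward edges of the cycle can be discarded without losing a neighbour.
  Conversely, in a minimal violating set \<open>X\<close> every \<open>x \<in> X\<close> shares at least two neighbours with
  \<open>X - {x}\<close>. So \<open>X\<close> together with the vertices having two neighbours in \<open>X\<close> induces a graph of
  minimum degree at least two. This graph contains a cycle, which has at most \<open>2|X|\<close> vertices.
\<close>

text \<open>Only strict upper bounds pass directly through an infimum. As \<open>enat\<close> is
  discrete, the bound by \<open>k\<close> is first rewritten as a strict bound by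
  \<open>Suc k\<close>. For empty \<open>A\<close> both sides are false.\<close>

lemma INF_enat_le_iff:
  fixes f :: "'i \<Rightarrow> nat"
  shows "(INF i\<in>A. enat (f i)) \<le> enat k \<longleftrightarrow> (\<exists>i\<in>A. f i \<le> k)"
proof -
  have "(INF i\<in>A. enat (f i)) \<le> enat k \<longleftrightarrow> (INF i\<in>A. enat (f i)) < enat (Suc k)"
    by (cases "INF i\<in>A. enat (f i)") auto
  then show ?thesis
    by (simp add: INF_less_iff less_Suc_eq_le)
qed

section \<open>Closed walks and the existence of simple cycles\<close>

lemma (in pre_digraph) cycle_tails_heads:
  assumes "cycle p"
  shows "distinct (map (tail G) p)" "distinct (map (head G) p)"
    "head G ` set p = tail G ` set p"
    "i < length p \<Longrightarrow> head G (p ! i) = tail G (p ! (Suc i mod length p))"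
proof -
  obtain u where u: "cas u p u" "distinct (tl (awalk_verts u p))" "p \<noteq> []"
    using assms by (auto simp: cycle_def awalk_def)
  have v: "awalk_verts u p = u # map (head G) p"
    using awalk_verts_conv'[OF u(1)] u(1,3) by (simp add: cas_simp)
  have "last (v # map (head G) q) = w" if "cas v q w" for v w q
    using that by (induct q arbitrary: v) auto
  then have "last (u # map (head G) p) = u"
    using u(1) by blast
  \<comment> \<open>The list of heads is the list of tails rotated by one place; all four claims are
    read off from this identity.\<close>
  then have eq: "map (tail G) p @ [u] = u # map (head G) p"
    using v u(3) by (simp add: awalk_verts_conv last_map)
  then have "mset (map (tail G) p @ [u]) = mset (u # map (head G) p)"
    by metis
  then have ms: "mset (map (tail G) p) = mset (map (head G) p)"
    by simp
  show dh: "distinct (map (head G) p)"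
    using u(2) v by simp
  show "distinct (map (tail G) p)"
    using dh mset_eq_imp_distinct_iff[OF ms] by simp
  show "head G ` set p = tail G ` set p"
    using mset_eq_setD[OF ms] by simp
  show "head G (p ! i) = tail G (p ! (Suc i mod length p))" if i: "i < length p"
  \<comment> \<open>For the last arc the successor index wraps around to 0, where the tail is the
    base point \<open>u\<close>.\<close>
  proof (cases "Suc i = length p")
    case True
    have "u = tail G (p ! 0)"
      using arg_cong[OF eq, of "\<lambda>xs. xs ! 0"] u(3) by (simp add: nth_append)
    then show ?thesis
      using arg_cong[OF eq, of "\<lambda>xs. xs ! Suc i"] i
      by (simp add: nth_append flip: True)
  next
    case False
    then show ?thesis
      using arg_cong[OF eq, of "\<lambda>xs. xs ! Suc i"] i by (simp add: nth_append)
  qed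
qed

text \<open>Two mutually reversed arcs would each be the cyclic successor of the other, so the
  length of \<open>p\<close> would divide 2. Length at least 3 excludes this.\<close>

lemma (in pre_digraph) simple_cycle_no_reversed_arc:
  assumes "simple_cycle G p" "e \<in> set p" "e' \<in> set p" "tail G e' = head G e"
  shows "head G e' \<noteq> tail G e"
proof
  assume rev: "head G e' = tail G e"
  let ?m = "length p"
  have cyc: "cycle p" and m: "3 \<le> ?m"
    using assms(1) by (auto simp: simple_cycle_def)
  note c = cycle_tails_heads[OF cyc]
  obtain i j where ij: "i < ?m" "p ! i = e" "j < ?m" "p ! j = e'"
    using assms(2,3) by (auto simp: in_set_conv_nth)
  have inj: "a = b" if "a < ?m" "b < ?m" "tail G (p ! a) = tail G (p ! b)" for a b
    using nth_eq_iff_index_eq[OF c(1), of a b] that by simp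
  have "j = Suc i mod ?m"
    using c(4)[OF ij(1)] assms(4) ij m by (intro inj) (auto intro!: mod_less_divisor)
  moreover have "i = Suc j mod ?m"
    using c(4)[OF ij(3)] rev ij m by (intro inj) (auto intro!: mod_less_divisor)
  ultimately have "i = Suc (Suc i) mod ?m"
    by (metis mod_Suc_eq)
  then show False
    using ij(1) m by (auto simp: mod_if split: if_splits)
qed

text \<open>Longest path argument: all neighbours in \<open>S\<close> of the start of a longest path
  in \<open>S\<close> lie on that path, and one that is not the second vertex closes a cycle. The
  degree condition is phrased as a neighbour avoiding any prescribed \<open>x\<close>.\<close>

lemma (in graph) simple_cycle_exists:
  assumes "S \<noteq> {}" "S \<subseteq> verts G"
    and deg: "\<And>v x. v \<in> S \<Longrightarrow> \<exists>w\<in>S. w \<noteq> x \<and> v \<rightarrow>\<^bsub>G\<^esub> w"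
  shows "\<exists>p. simple_cycle G p \<and> tail G ` set p \<subseteq> S"
proof -
  define P where "P n \<longleftrightarrow> (\<exists>u p v. apath u p v \<and> set (awalk_verts u p) \<subseteq> S \<and> length p = n)" for n
  obtain v0 where "v0 \<in> S"
    using assms(1) by auto
  then have P0: "P 0"
    using assms(2) by (auto simp: P_def apath_Nil_iff intro!: exI[of _ v0] exI[of _ "[]"])
  have bound: "\<forall>n. P n \<longrightarrow> n \<le> card (verts G)"
    by (auto simp: P_def dest: length_apath)
  obtain n where n: "P n" "\<And>k. P k \<Longrightarrow> k \<le> n"
    using Nat.ex_has_greatest_nat[OF P0 bound] by blast
  then obtain u p v where p: "apath u p v" "set (awalk_verts u p) \<subseteq> S" "length p = n"
    by (auto simp: P_def)
  then have uS: "u \<in> S"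
    using hd_in_awalk_verts(2) by blast
  \<comment> \<open>\<open>head G (hd p)\<close> is the second vertex of the path. For
    \<open>p = []\<close> it is an unspecified value, which does no harm.\<close>
  obtain w where w: "w \<in> S" "w \<noteq> head G (hd p)" "u \<rightarrow>\<^bsub>G\<^esub> w"
    using deg[OF uS] by blast
  then have "w \<rightarrow>\<^bsub>G\<^esub> u"
    using sym_arcs by (auto intro: arcs_ends_symmetric)
  then obtain a where a: "a \<in> arcs G" "tail G a = w" "head G a = u"
    by (auto simp: arcs_ends_conv)
  then have wu: "w \<noteq> u"
    using no_loops[OF a(1)] by simp
  \<comment> \<open>Otherwise prepending \<open>a\<close> would give a longer path in
    \<open>S\<close>.\<close>
  have "w \<in> set (awalk_verts u p)"
  proof (rule ccontr)
    assume "w \<notin> set (awalk_verts u p)"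
    then have "apath w (a # p) v" "set (awalk_verts w (a # p)) \<subseteq> S"
      using p a w by (auto simp: apath_Cons_iff)
    then have "P (Suc n)"
      using p(3) unfolding P_def by (metis length_Cons)
    then show False
      using n(2) by fastforce
  qed
  then obtain q r where qr: "p = q @ r" "awalk u q w"
    using awalk_decomp[OF awalkI_apath[OF p(1)]] by blast
  have "apath u q (awlast u q)"
    using p(1) unfolding qr(1) apath_append_iff by blast
  moreover have "awlast u q = w"
    using qr(2) by (rule awalkE)
  ultimately have "apath u q w"
    by simp
  have "q \<noteq> []"
    using qr(2) wu by (auto simp: awalk_Nil_iff)
  \<comment> \<open>A single arc would be \<open>hd p\<close>, whose head \<open>w\<close> was
    chosen to avoid. Hence \<open>a # q\<close> has at least three arcs.\<close>
  moreover have "length q \<noteq> 1"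
    using qr w(2) by (auto simp: length_Suc_conv awalk_simps)
  ultimately have "2 \<le> length q"
    by (cases q; cases "tl q") auto
  then have "simple_cycle G (a # q)"
    using \<open>apath u q w\<close> a
    by (auto simp: simple_cycle_def cycle_def awalk_Cons_iff apath_def intro!: exI[of _ w])
  moreover have "tail G ` set (a # q) \<subseteq> S"
    using p(2) w(1) a(2) qr(1) by (auto simp: awalk_verts_conv split: if_splits)
  ultimately show ?thesis
    by blast
qed

section \<open>Edge and cycle counts in left-regular bipartite graphs\<close>

locale left_regular_bipartite_graph = graph G for G :: "('a, 'b) pre_digraph" +
  fixes L R :: "'a set" and d :: nat
  assumes bipartite: "bipartite_graph G L R" and regular: "left_regular G L d"
begin

abbreviation "N \<equiv> neighbourhood G"

lemma parts: "verts G = L \<union> R" "L \<inter> R = {}"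
  and arc_parts: "e \<in> arcs G \<Longrightarrow> tail G e \<in> L \<longleftrightarrow> head G e \<in> R"
  using bipartite by (auto simp: bipartite_graph_def)

lemma finite_L: "finite L"
  using parts(1) finite_verts by (metis finite_Un)

lemma neighbourhood_eq_heads: "N X = head G ` {e \<in> arcs G. tail G e \<in> X}"
  by (auto simp: neighbourhood_def arcs_ends_conv image_iff)

lemma finite_neighbourhood: "finite (N X)"
  by (simp add: neighbourhood_eq_heads)

lemma neighbourhood_Un: "N (X \<union> Y) = N X \<union> N Y"
  by (auto simp: neighbourhood_eq_heads)

lemma card_out_arcs_set:
  assumes "X \<subseteq> L"
  shows "card {e \<in> arcs G. tail G e \<in> X} = d * card X"
proof -
  have "finite X"
    using assms finite_L finite_subset by blast
  have "{e \<in> arcs G. tail G e \<in> X} = (\<Union>x\<in>X. out_arcs G x)"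
    by auto
  also have "card \<dots> = (\<Sum>x\<in>X. card (out_arcs G x))"
    using \<open>finite X\<close> by (intro card_UN_disjoint) auto
  also have "\<dots> = (\<Sum>x\<in>X. d)"
    using assms regular by (intro sum.cong) (auto simp: left_regular_def out_degree_def)
  finally show ?thesis
    by simp
qed

lemma card_neighbourhood_singleton:
  assumes "x \<in> L"
  shows "card (N {x}) = d"
proof -
  have "inj_on (head G) {e \<in> arcs G. tail G e \<in> {x}}"
    by (auto simp: inj_on_def arc_to_ends_def intro!: no_multi_arcs)
  then show ?thesis
    using card_out_arcs_set[of "{x}"] assms by (simp add: neighbourhood_eq_heads card_image)
qed

text \<open>On the cycle arcs leaving \<open>L\<close>, the tail map is a bijection onto the left
  vertices of the cycle and the head map a bijection onto its right vertices.\<close>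

lemma card_cycle_arcs_from_L:
  assumes "cycle p"
  shows "card {e \<in> set p. tail G e \<in> L} = card (tail G ` set p \<inter> L)"
    and "card (tail G ` set p) = 2 * card (tail G ` set p \<inter> L)"
proof -
  let ?F = "{e \<in> set p. tail G e \<in> L}" and ?T = "tail G ` set p"
  note c = cycle_tails_heads[OF assms]
  have sub: "set p \<subseteq> arcs G"
    using assms by (auto simp: cycle_def)
  have inj: "inj_on (tail G) ?F" "inj_on (head G) ?F"
    using c(1,2) by (auto simp: distinct_map intro: inj_on_subset)
  have "tail G ` ?F = ?T \<inter> L"
    by auto
  then show FL: "card ?F = card (?T \<inter> L)"
    using card_image[OF inj(1)] by simp
  have "head G ` ?F = head G ` set p \<inter> R"
    using sub arc_parts by auto
  then have FR: "card ?F = card (?T \<inter> R)"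
    using card_image[OF inj(2)] c(3) by simp
  have T: "?T = (?T \<inter> L) \<union> (?T \<inter> R)"
    using sub parts(1) tail_in_verts by blast
  have "card ((?T \<inter> L) \<union> (?T \<inter> R)) = card (?T \<inter> L) + card (?T \<inter> R)"
    using parts(2) by (intro card_Un_disjoint) auto
  then have "card ?T = card (?T \<inter> L) + card (?T \<inter> R)"
    using T by simp
  then show "card ?T = 2 * card (?T \<inter> L)"
    using FL FR by simp
qed

text \<open>Among the \<open>d * card K\<close> arcs leaving \<open>K\<close>, those on the cycle
  are redundant: each of their heads is also reached from \<open>K\<close> by an arc off the
  cycle.\<close>

lemma card_neighbourhood_cycle:
  assumes p: "simple_cycle G p"
  defines "K \<equiv> tail G ` set p \<inter> L"
  shows "card (N K) + card K \<le> d * card K"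
proof -
  let ?A = "{e \<in> arcs G. tail G e \<in> K}" and ?F = "{e \<in> set p. tail G e \<in> L}"
  have cyc: "cycle p"
    using p by (simp add: simple_cycle_def)
  have sub: "set p \<subseteq> arcs G"
    using cyc by (auto simp: cycle_def)
  have FA: "?F \<subseteq> ?A"
    using sub by (auto simp: K_def)
  have "N K \<subseteq> head G ` (?A - ?F)"
  proof
    fix r assume "r \<in> N K"
    then obtain e where e: "e \<in> arcs G" "tail G e \<in> K" "head G e = r"
      by (auto simp: neighbourhood_eq_heads)
    show "r \<in> head G ` (?A - ?F)"
    proof (cases "e \<in> ?F")
      case False
      then show ?thesis
        using e by auto
    next
      case True
      then have "r \<in> tail G ` set p"
        using e(3) cycle_tails_heads(3)[OF cyc] by blast
      \<comment> \<open>\<open>f\<close> is the cycle arc leaving \<open>r\<close>. Its reversal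
        \<open>g\<close> enters \<open>r\<close> from \<open>K\<close> and is not on the cycle, so
        it can replace \<open>e\<close>.\<close>
      then obtain f where f: "f \<in> set p" "tail G f = r"
        by auto
      have "r \<in> R"
        using e arc_parts by (auto simp: K_def)
      have "tail G f \<rightarrow>\<^bsub>G\<^esub> head G f"
        using f sub in_arcs_imp_in_arcs_ends by auto
      then have "head G f \<rightarrow>\<^bsub>G\<^esub> tail G f"
        using sym_arcs by (auto intro: arcs_ends_symmetric)
      then obtain g where g: "g \<in> arcs G" "tail G g = head G f" "head G g = r"
        using f(2) by (auto simp: arcs_ends_conv)
      have "g \<notin> set p"
        using simple_cycle_no_reversed_arc[OF p f(1), of g] g f by auto
      moreover have "tail G g \<in> K"
        using g \<open>r \<in> R\<close> arc_parts[OF g(1)] f(1) cycle_tails_heads(3)[OF cyc]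
        by (auto simp: K_def)
      ultimately show ?thesis
        using g by auto
    qed
  qed
  then have "card (N K) \<le> card (?A - ?F)"
    by (auto intro: surj_card_le)
  also have "\<dots> = card ?A - card ?F"
    using FA by (intro card_Diff_subset) auto
  finally have "card (N K) \<le> card ?A - card ?F" .
  \<comment> \<open>Makes the truncated subtraction above exact.\<close>
  moreover have "card ?F \<le> card ?A"
    using FA by (intro card_mono) auto
  moreover have "card ?A = d * card K"
    by (rule card_out_arcs_set) (simp add: K_def)
  moreover have "card ?F = card K"
    using card_cycle_arcs_from_L(1)[OF cyc] by (simp add: K_def)
  ultimately show ?thesis
    by linarith
qed

section \<open>Large girth forces expansion\<close>

lemma card_neighbourhood_ge:
  assumes no_cycle: "\<And>p. simple_cycle G p \<Longrightarrow> 2 * s < card (tail G ` set p)"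
    and "X \<subseteq> L" "0 < card X" "card X \<le> s"
  shows "d * card X < card (N X) + card X"
  using assms(2-4)
proof (induction "card X" arbitrary: X rule: less_induct)
  case less
  have finX: "finite X"
    using less.prems(2) card_gt_0_iff by blast
  \<comment> \<open>The first summand counts the private neighbours of \<open>x\<close>.\<close>
  have split: "card (N X) = card (N {x} - N (X - {x})) + card (N (X - {x}))" if "x \<in> X" for x
  proof -
    have "N X = (N {x} - N (X - {x})) \<union> N (X - {x})"
      using neighbourhood_Un[of "{x}" "X - {x}"] that by (auto simp: insert_absorb)
    then show ?thesis
      using card_Un_disjoint[of "N {x} - N (X - {x})" "N (X - {x})"] finite_neighbourhood by auto
  qed
  show ?case
  proof (cases "card X = 1")
    case True
    obtain x where X: "X = {x}"
      using True by (rule card_1_singletonE)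
    then have "card (N X) = d"
      using card_neighbourhood_singleton less.prems(1) by simp
    then show ?thesis
      using True by simp
  next
    case False
    show ?thesis
    proof (rule ccontr)
      assume small: "\<not> ?thesis"
      \<comment> \<open>Since \<open>X - {x}\<close> satisfies the bound and \<open>X\<close> does
        not, \<open>x\<close> has at most \<open>d - 2\<close> private neighbours, so at least two
        of its \<open>d\<close> neighbours are shared and one of them avoids
        \<open>z\<close>.\<close>
      have shared: "\<exists>w \<in> N {x} \<inter> N (X - {x}). w \<noteq> z" if x: "x \<in> X" for x z
      proof -
        have cX: "card X = Suc (card (X - {x}))"
          by (rule card.remove[OF finX x])
        have "d * card (X - {x}) < card (N (X - {x})) + card (X - {x})"
          using cX False less.prems by (intro less.hyps) auto
        then have "card (N {x} - N (X - {x})) + 2 \<le> d"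
          using small split[OF x] cX by simp
        moreover have "d = card (N {x} - N (X - {x})) + card (N {x} \<inter> N (X - {x}))"
          using card_neighbourhood_singleton[of x] x less.prems(1) finite_neighbourhood
            card_Int_Diff[of "N {x}" "N (X - {x})"] by auto
        ultimately have "2 \<le> card (N {x} \<inter> N (X - {x}))"
          by linarith
        then have "\<not> N {x} \<inter> N (X - {x}) \<subseteq> {z}"
          using card_mono[of "{z}" "N {x} \<inter> N (X - {x})"] by auto
        then show ?thesis
          by blast
      qed
      define Y where "Y = {r \<in> verts G. \<exists>x\<in>X. \<exists>y\<in>X. x \<noteq> y \<and> x \<rightarrow>\<^bsub>G\<^esub> r \<and> y \<rightarrow>\<^bsub>G\<^esub> r}"
      have YR: "Y \<subseteq> R"
        using less.prems(1) arc_parts by (auto simp: Y_def arcs_ends_conv)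
      have "\<exists>p. simple_cycle G p \<and> tail G ` set p \<subseteq> X \<union> Y"
      proof (rule simple_cycle_exists)
        show "X \<union> Y \<noteq> {}" "X \<union> Y \<subseteq> verts G"
          using less.prems parts(1) by (auto simp: Y_def)
        show "\<exists>w\<in>X \<union> Y. w \<noteq> z \<and> v \<rightarrow>\<^bsub>G\<^esub> w" if "v \<in> X \<union> Y" for v z
        proof (cases "v \<in> X")
          case True
          then obtain w where "w \<in> N {v} \<inter> N (X - {v})" "w \<noteq> z"
            using shared by blast
          then have "w \<in> Y" "v \<rightarrow>\<^bsub>G\<^esub> w"
            using True by (auto simp: Y_def neighbourhood_def)
          then show ?thesis
            using \<open>w \<noteq> z\<close> by blast
        next
          case False
          \<comment> \<open>Of two distinct neighbours at least one differs from
            \<open>z\<close>.\<close>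
          then obtain x y where "x \<in> X" "y \<in> X" "x \<noteq> y" "x \<rightarrow>\<^bsub>G\<^esub> v" "y \<rightarrow>\<^bsub>G\<^esub> v"
            using \<open>v \<in> X \<union> Y\<close> by (auto simp: Y_def)
          then show ?thesis
            using arcs_ends_symmetric[OF sym_arcs] by (metis UnI1)
        qed
      qed
      then obtain p where p: "simple_cycle G p" "tail G ` set p \<subseteq> X \<union> Y"
        by blast
      have "tail G ` set p \<inter> L \<subseteq> X"
        using p(2) YR parts(2) by blast
      \<comment> \<open>Bounding the left half suffices: the whole cycle has exactly twice as many
        vertices, hence at most \<open>2 * s\<close>.\<close>
      then have "card (tail G ` set p \<inter> L) \<le> card X"
        using finX by (rule card_mono[rotated])
      then show False
        using no_cycle[OF p(1)] card_cycle_arcs_from_L(2)[of p] p(1) less.prems(3)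
        by (simp add: simple_cycle_def)
    qed
  qed
qed

section \<open>Expansion as an integer inequality, and the equivalence with girth\<close>

lemma expansion_ge_iff:
  assumes "1 \<le> t" "t \<le> card L"
  shows "c \<le> expansion G L t \<longleftrightarrow>
    (\<forall>X\<subseteq>L. 0 < card X \<longrightarrow> card X \<le> t \<longrightarrow> c \<le> real (card (N X)) / real (card X))"
proof -
  let ?P = "\<lambda>X. X \<subseteq> L \<and> 0 < card X \<and> card X \<le> t"
  have "finite {X. ?P X}"
    by (rule finite_subset[of _ "Pow L"]) (auto simp: finite_L)
  then have "finite {real (card (N X)) / real (card X) | X. ?P X}"
    by simp
  \<comment> \<open>A witness that \<open>Min\<close> is taken over a nonempty set.\<close>
  moreover obtain X where "X \<subseteq> L" "card X = t"
    using obtain_subset_with_card_n[OF assms(2)] by metis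
  then have "{real (card (N X)) / real (card X) | X. ?P X} \<noteq> {}"
    using assms(1) by auto
  ultimately show ?thesis
    unfolding expansion_def by (subst Min_ge_iff) auto
qed

text \<open>Clearing denominators at \<open>t = card X\<close> turns the bound into a comparison of
  integers, where the summand 1 becomes strictness. This frees the later argument from ratios and
  from \<open>t\<close>.\<close>

lemma optimal_small_set_expander_iff:
  assumes "s \<le> card L"
  shows "optimal_small_set_expander G L d s \<longleftrightarrow>
    (\<forall>X\<subseteq>L. 0 < card X \<longrightarrow> card X \<le> s \<longrightarrow> d * card X < card (N X) + card X)"
proof -
  have ratio: "(real d - 1) + 1 / real (card X) \<le> real (card (N X)) / real (card X) \<longleftrightarrow>
      d * card X < card (N X) + card X" if "0 < card X" for X :: "'a set"
  proof -
    have "(real d - 1) + 1 / real (card X) =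
        (real d * real (card X) + 1 - real (card X)) / real (card X)"
      using that by (simp add: field_simps)
    then have "(real d - 1) + 1 / real (card X) \<le> real (card (N X)) / real (card X) \<longleftrightarrow>
        real d * real (card X) + 1 - real (card X) \<le> real (card (N X))"
      using that by (simp only: divide_le_cancel) simp
    also have "\<dots> \<longleftrightarrow> real d * real (card X) + 1 \<le> real (card (N X)) + real (card X)"
      by (rule diff_le_eq)
    also have "\<dots> \<longleftrightarrow> real (d * card X + 1) \<le> real (card (N X) + card X)"
      by (simp add: add.commute)
    also have "\<dots> \<longleftrightarrow> d * card X < card (N X) + card X"
      unfolding of_nat_le_iff by auto
    finally show ?thesis .
  qed
  show ?thesis
  proof (intro iffI allI impI)
    fix X assume opt: "optimal_small_set_expander G L d s"
      and X: "X \<subseteq> L" "0 < card X" "card X \<le> s"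
    then have "(real d - 1) + 1 / real (card X) \<le> expansion G L (card X)"
      by (simp add: optimal_small_set_expander_def)
    then have "(real d - 1) + 1 / real (card X) \<le> real (card (N X)) / real (card X)"
      using expansion_ge_iff[of "card X"] X assms by simp
    then show "d * card X < card (N X) + card X"
      using ratio[OF X(2)] by simp
  next
    assume *: "\<forall>X\<subseteq>L. 0 < card X \<longrightarrow> card X \<le> s \<longrightarrow> d * card X < card (N X) + card X"
    show "optimal_small_set_expander G L d s"
      unfolding optimal_small_set_expander_def
    proof (intro allI impI)
      fix t assume t: "1 \<le> t \<and> t \<le> s"
      have "(real d - 1) + 1 / real t \<le> real (card (N X)) / real (card X)"
        if X: "X \<subseteq> L" "0 < card X" "card X \<le> t" for X
      proof -
        \<comment> \<open>A set smaller than \<open>t\<close> meets the stronger bound for its own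
          size.\<close>
        have "1 / real t \<le> 1 / real (card X)"
          using X by (intro divide_left_mono) auto
        moreover have "(real d - 1) + 1 / real (card X) \<le> real (card (N X)) / real (card X)"
          using * X t by (subst ratio) auto
        ultimately show ?thesis
          by linarith
      qed
      then show "(real d - 1) + 1 / real t \<le> expansion G L t"
        using t assms by (subst expansion_ge_iff) auto
    qed
  qed
qed

text \<open>For the backward direction, the left vertices of a cycle form a nonempty set violating
  the integer inequality, so there are more than \<open>s\<close> of them.\<close>

lemma girth_gt_iff_optimal:
  assumes "s \<le> card L"
  shows "girth G > enat (2 * s) \<longleftrightarrow> optimal_small_set_expander G L d s"
proof -
  have girth: "girth G > enat (2 * s) \<longleftrightarrow>
      (\<forall>p. simple_cycle G p \<longrightarrow> 2 * s < card (tail G ` set p))"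
    unfolding girth_def not_le[symmetric] INF_enat_le_iff by auto
  show ?thesis
    unfolding girth optimal_small_set_expander_iff[OF assms]
  proof (intro iffI allI impI)
    fix X
    assume "\<forall>p. simple_cycle G p \<longrightarrow> 2 * s < card (tail G ` set p)"
      and "X \<subseteq> L" "0 < card X" "card X \<le> s"
    then show "d * card X < card (N X) + card X"
      using card_neighbourhood_ge by blast
  next
    fix p
    assume exp: "\<forall>X\<subseteq>L. 0 < card X \<longrightarrow> card X \<le> s \<longrightarrow> d * card X < card (N X) + card X"
      and p: "simple_cycle G p"
    let ?K = "tail G ` set p \<inter> L"
    have card: "card (tail G ` set p) = 2 * card ?K"
      using p card_cycle_arcs_from_L(2) by (simp add: simple_cycle_def)
    moreover have "set p \<noteq> {}"
      using p by (auto simp: simple_cycle_def)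
    ultimately have "0 < card ?K"
      by (metis card_gt_0_iff finite_imageI finite_set image_is_empty mult_0_right neq0_conv)
    moreover have "\<not> d * card ?K < card (N ?K) + card ?K"
      using card_neighbourhood_cycle[OF p] by simp
    ultimately have "s < card ?K"
      using exp by (meson inf_le2 not_le)
    then show "2 * s < card (tail G ` set p)"
      using card by simp
  qed
qed

end

theorem theorem1p4:
  fixes G :: "('a, 'b) pre_digraph" and L R :: "'a set" and d n s :: nat
  assumes "bipartite_graph G L R"
    and "left_regular G L d"
    and "n = card L"
    and "2 \<le> s" and "s \<le> n"
  shows "girth G > enat (2 * s) \<longleftrightarrow> optimal_small_set_expander G L d s"
proof -
  interpret graph G
    using assms(1) by (simp add: bipartite_graph_def)
  interpret left_regular_bipartite_graph G L R d
    using assms(1,2) by unfold_locales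
  show ?thesis
    using girth_gt_iff_optimal assms(3,5) by simp
qed

end
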